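(* Consider the linear-quadratic Gaussian (LQG) control problem of minimizing $$J=\mathrm{E}\Big\{x_N^{\mathrm T}Q_Nx_N+\sum_{t=0}^{N-1}\big(x_t^{\mathrm T}Qx_t+u_t^{\mathrm T}Ru_t\big)\Big\}$$ subject to $$x_{t+1}=Ax_t+Bu_t+\xi_t,\qquad y_t=Hx_t+\omega_t .$$ Let its solution be given by the control law $u_t=-L_t\hat x_t$ and the filter $\hat x_{t+1}=A\hat x_t+Bu_t+K_t(y_t-H\hat x_t)$, initialized with $\hat x_0=\mathrm{E}\{x_0\}$, with control matrices $L_t$ and filter matrices $K_t$ $$L_t=(R+B^{\mathrm T}Z_{t+1}B)^{-1}B^{\mathrm T}Z_{t+1}A,\qquad K_t=AP_tH^{\mathrm T}(HP_tH^{\mathrm T}+\Omega^{\omega})^{-1},$$ where $Z_t$ and $P_t$ are the solutions of the control and filter Riccati difference equations with $Z_N=Q_N$ and $P_0=\Omega_0^x$ given in the context. Then the mean $\mathrm{E}\{x_t\}$ and the covariance $\Omega_t^x=\mathrm{cov}(x_t)$ of $x_t$ are computed, for $t=0,\dots,N-1$, by the recursions $$\begin{bmatrix}\mathrm{E}\{x_{t+1}\}\\ \mathrm{E}\{\hat x_{t+1}\}\end{bmatrix}=\mathcal A_t\begin{bmatrix}\mathrm{E}\{x_t\}\\ \mathrm{E}\{\hat x_t\}\end{bmatrix},$$ $$\begin{bmatrix}\Omega_{t+1}^{x}&\Omega_{t+1}^{x\hat x}\\ \Omega_{t+1}^{\hat xx}&\Omega_{t+1}^{\hat x}\end{bmatrix}=\mathcal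 A_t\begin{bmatrix}\Omega_{t}^{x}&\Omega_{t}^{x\hat x}\\ \Omega_{t}^{\hat xx}&\Omega_{t}^{\hat x}\end{bmatrix}\mathcal A_t^{\mathrm T}+\begin{bmatrix}\Omega^{\xi}&0\\ 0&K_t\Omega^{\omega}K_t^{\mathrm T}\end{bmatrix},$$ where $\Omega_t^{x\hat x}=\mathrm{cov}(x_t,\hat x_t)$, $\Omega_t^{\hat xx}=\mathrm{cov}(\hat x_t,x_t)$, $\Omega_t^{\hat x}=\mathrm{cov}(\hat x_t)$, $$\mathcal A_t=\begin{bmatrix}A&-BL_t\\ K_tH&A-K_tH-BL_t\end{bmatrix},$$ with initial values $\mathrm{E}\{\hat x_0\}=\hat x_0=\mathrm{E}\{x_0\}$ and $$\begin{bmatrix}\Omega_{0}^{x}&\Omega_{0}^{x\hat x}\\ \Omega_{0}^{\hat xx}&\Omega_{0}^{\hat x}\end{bmatrix}=\begin{bmatrix}\Omega_0^x&0\\ 0&0\end{bmatrix}.$$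
   Context: Time is discrete, $t=0,1,\dots,N$. $x_t\in\mathbb R^n$ is the (random) system state, $u_t\in\mathbb R^m$ the control, $y_t\in\mathbb R^r$ the observed output, $\hat x_t\in\mathbb R^n$ the state estimate. $A,B,H$ are real matrices of appropriate dimensions; they may depend on time $t$ (the time index is suppressed). For random vectors $a,b$: $\mathrm{cov}(a,b)=\mathrm{E}\{(a-\mathrm{E}\{a\})(b-\mathrm{E}\{b\})^{\mathrm T}\}$ and $\mathrm{cov}(a)=\mathrm{cov}(a,a)$. Noise: $\xi_t=\Sigma^{\xi}\alpha_t$ and $\omega_t=\Sigma^{\omega}\beta_t$, where $\alpha_t\in\mathbb R^p$, $\beta_t\in\mathbb R^q$ are standard white Gaussian noise processes (zero mean, identity covariance, independent across time) and $\Sigma^\xi,\Sigma^\omega$ are constant matrices. Hence $\Omega^\xi=\mathrm{cov}(\xi_t)=\Sigma^\xi(\Sigma^\xi)^{\mathrm T}$ (positive semi-definite) and $\Omega^\omega=\mathrm{cov}(\omega_t)=\Sigma^\omega(\Sigma^\omega)^{\mathrm T}$, assumed positive definite. The two noise processes are independent of each other and of the state $x_t$, in the usual sense that the initial state $x_0$ and all $\xi_s,\omega_s$ ($s\ge 0$) are mutually independent (so $\xi_t,\omega_t$ are independent of the current pair $(x_t,\hat x_t)$). The mean $\mathrm{E}\{x_0\}$ and the covariance $\Omega_0^x=\mathrm{cov}(x_0)$ (positive semi-definite) are given. Cost matrices: $Q_N,Q,R$ are symmetric, $Q_N,Q$ positive semi-definite, $R$ positive definite. Riccati difference equations (standard for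 LQG): backward, $Z_N=Q_N$, $Z_t=Q+A^{\mathrm T}Z_{t+1}(A-BL_t)$; forward, $P_0=\Omega_0^x$, $P_{t+1}=\Omega^\xi+(A-K_tH)P_tA^{\mathrm T}$. *)

theory Defs
  imports "HOL-Probability.Probability"
begin

definition cov :: "'w measure \<Rightarrow> ('w \<Rightarrow> real^'a) \<Rightarrow> ('w \<Rightarrow> real^'b) \<Rightarrow> real^'b^'a" where
  "cov M a b = (LINT w|M.
     (columnvector (a w - (LINT v|M. a v)) :: real^1^'a) **
     transpose (columnvector (b w - (LINT v|M. b v)) :: real^1^'b))"

definition pos_semidef :: "real^'n^'n \<Rightarrow> bool" where
  "pos_semidef S \<longleftrightarrow> transpose S = S \<and> (\<forall>v. 0 \<le> v \<bullet> (S *v v))"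

definition pos_def :: "real^'n^'n \<Rightarrow> bool" where
  "pos_def S \<longleftrightarrow> transpose S = S \<and> (\<forall>v. v \<noteq> 0 \<longrightarrow> 0 < v \<bullet> (S *v v))"

definition stack_vec :: "real^'a \<Rightarrow> real^'b \<Rightarrow> real^('a + 'b)" where
  "stack_vec v w = (\<chi> i. case i of Inl a \<Rightarrow> v $ a | Inr b \<Rightarrow> w $ b)"

definition block_mat ::
  "real^'c^'a \<Rightarrow> real^'d^'a \<Rightarrow> real^'c^'b \<Rightarrow> real^'d^'b \<Rightarrow> real^('c + 'd)^('a + 'b)" where
  "block_mat S11 S12 S21 S22 = (\<chi> i j.
     (case i of
        Inl a \<Rightarrow> (case j of Inl c \<Rightarrow> S11 $ a $ c | Inr d \<Rightarrow> S12 $ a $ d)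
      | Inr b \<Rightarrow> (case j of Inl c \<Rightarrow> S21 $ b $ c | Inr d \<Rightarrow> S22 $ b $ d)))"

definition joint_cov :: "'w measure \<Rightarrow> ('w \<Rightarrow> real^'a) \<Rightarrow> ('w \<Rightarrow> real^'b) \<Rightarrow> real^('a + 'b)^('a + 'b)" where
  "joint_cov M a b = block_mat (cov M a a) (cov M a b) (cov M b a) (cov M b b)"

definition std_gaussian_vec :: "'w measure \<Rightarrow> ('w \<Rightarrow> real^'p) \<Rightarrow> bool" where
  "std_gaussian_vec M X \<longleftrightarrow>
     prob_space.indep_vars M (\<lambda>_. borel) (\<lambda>i w. X w $ i) UNIV \<and>
     (\<forall>i. distributed M lborel (\<lambda>w. X w $ i) (\<lambda>s. ennreal (std_normal_density s)))"

definition std_white_gaussian :: "'w measure \<Rightarrow> (nat \<Rightarrow> 'w \<Rightarrow> real^'p) \<Rightarrow> bool" where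
  "std_white_gaussian M \<alpha> \<longleftrightarrow>
     (\<forall>t. std_gaussian_vec M (\<alpha> t)) \<and> prob_space.indep_vars M (\<lambda>_. borel) \<alpha> UNIV"

datatype source = Initial | Process_Noise nat | Output_Noise nat

definition generated_events :: "'w measure \<Rightarrow> ('w \<Rightarrow> real^'a) \<Rightarrow> 'w set set" where
  "generated_events M X = {X -` S \<inter> space M | S. S \<in> sets borel}"

text \<open>
  Mutual independence of the whole family consisting of the initial state and of all noise vectors.
  Its members take values in spaces of different dimension, whereas \<open>indep_vars\<close> requires one
  common value type, so its definition in terms of \<open>indep_sets\<close> is written out.
\<close>
definition mutually_indep ::
  "'w measure \<Rightarrow> ('w \<Rightarrow> real^'n) \<Rightarrow> (nat \<Rightarrow> 'w \<Rightarrow> real^'n) \<Rightarrow> (nat \<Rightarrow> 'w \<Rightarrow> real^'r) \<Rightarrow> bool" where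
  "mutually_indep M x0 \<xi> \<omega> \<longleftrightarrow>
     x0 \<in> borel_measurable M \<and>
     (\<forall>s. \<xi> s \<in> borel_measurable M) \<and>
     (\<forall>s. \<omega> s \<in> borel_measurable M) \<and>
     prob_space.indep_sets M
       (\<lambda>k. case k of
              Initial \<Rightarrow> generated_events M x0
            | Process_Noise s \<Rightarrow> generated_events M (\<xi> s)
            | Output_Noise s \<Rightarrow> generated_events M (\<omega> s)) UNIV"

definition closed_loop_mat ::
  "real^'n^'n \<Rightarrow> real^'m^'n \<Rightarrow> real^'n^'r \<Rightarrow> real^'n^'m \<Rightarrow> real^'r^'n \<Rightarrow> real^('n + 'n)^('n + 'n)" where
  "closed_loop_mat A B H L K =
     block_mat A (- (B ** L)) (K ** H) (A - K ** H - B ** L)"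

end

theory Submission
  imports Defs
begin

text \<open>
  Stack state and estimate into one vector \<open>z\<^sub>t = (x\<^sub>t, xhat\<^sub>t)\<close> and the two noises into
  \<open>e\<^sub>t = (\<xi>\<^sub>t, \<omega>\<^sub>t)\<close>. Substituting control law and output into the dynamics turns them into a
  single linear recursion \<open>z\<^sub>t\<^sub>+\<^sub>1 = F\<^sub>t z\<^sub>t + G\<^sub>t e\<^sub>t\<close>, where \<open>F\<^sub>t\<close> is the closed-loop matrix and
  \<open>G\<^sub>t\<close> is block diagonal with blocks \<open>1\<close> and \<open>K\<^sub>t\<close>. Since \<open>e\<^sub>t\<close> is centred and uncorrelated with
  \<open>z\<^sub>t\<close>, taking means gives \<open>E z\<^sub>t\<^sub>+\<^sub>1 = F\<^sub>t (E z\<^sub>t)\<close>, and expanding the bilinear covariance leaves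
  \<open>cov z\<^sub>t\<^sub>+\<^sub>1 = F\<^sub>t (cov z\<^sub>t) F\<^sub>t\<^sup>T + G\<^sub>t (cov e\<^sub>t) G\<^sub>t\<^sup>T\<close>, the cross terms being zero. This is
  \<open>moments_of_linear_update\<close>; read in blocks, it is the asserted pair of recursions.

  What remains is that \<open>z\<^sub>t\<close> is uncorrelated with \<open>e\<^sub>t\<close>. Independence of \<open>e\<^sub>t\<close> from the whole
  past would imply it, but the invariant needed is weaker and simpler to propagate: \<open>z\<^sub>t\<close> is a linear
  image of \<open>z\<^sub>0, e\<^sub>0, \<dots>, e\<^sub>t\<^sub>-\<^sub>1\<close>, each uncorrelated with every \<open>e\<^sub>k\<close>, \<open>k \<ge> t\<close>, and being
  uncorrelated with a fixed vector is preserved by linear maps and sums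
  (\<open>linear_recursion_uncorrelated\<close>). Independence thus enters through pairs of sources
  (\<open>mutually_indep_pair\<close>, \<open>cov_eq_0_if_indep\<close>), and the law of the noise through its first two
  moments (\<open>std_gaussian_vec_moments\<close>).
\<close>

section \<open>Block vectors and block matrices\<close>

lemma sum_UNIV_Plus:
  "(\<Sum>k\<in>(UNIV::('c::finite + 'd::finite) set). f k) =
     (\<Sum>c\<in>UNIV. f (Inl c)) + (\<Sum>d\<in>UNIV. f (Inr d))"
  unfolding UNIV_Plus_UNIV[symmetric] by (subst sum.Plus) (auto simp: sum.Plus)

lemma stack_vec_nth [simp]:
  "stack_vec v w $ Inl i = v $ i" "stack_vec v w $ Inr j = w $ j"
  by (simp_all add: stack_vec_def)

lemma block_mat_nth [simp]:
  "block_mat S11 S12 S21 S22 $ Inl a $ Inl c = S11 $ a $ c"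
  "block_mat S11 S12 S21 S22 $ Inl a $ Inr d = S12 $ a $ d"
  "block_mat S11 S12 S21 S22 $ Inr b $ Inl c = S21 $ b $ c"
  "block_mat S11 S12 S21 S22 $ Inr b $ Inr d = S22 $ b $ d"
  by (simp_all add: block_mat_def)

lemma vec_sum_eq_iff:
  "(v :: 'x^('a::finite + 'b::finite)) = w \<longleftrightarrow> (\<forall>i. v $ Inl i = w $ Inl i) \<and> (\<forall>j. v $ Inr j = w $ Inr j)"
  by (auto simp: vec_eq_iff) (metis sum.exhaust)

lemma mat_sum_eq_iff:
  "(S :: 'x^('c::finite + 'd::finite)^('a::finite + 'b::finite)) = T \<longleftrightarrow>
     (\<forall>i j. S $ Inl i $ Inl j = T $ Inl i $ Inl j) \<and> (\<forall>i j. S $ Inl i $ Inr j = T $ Inl i $ Inr j) \<and>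
     (\<forall>i j. S $ Inr i $ Inl j = T $ Inr i $ Inl j) \<and> (\<forall>i j. S $ Inr i $ Inr j = T $ Inr i $ Inr j)"
  by (auto simp: vec_sum_eq_iff)

lemma block_mat_mult_stack_vec:
  "block_mat S11 S12 S21 S22 *v stack_vec v w = stack_vec (S11 *v v + S12 *v w) (S21 *v v + S22 *v w)"
  by (simp add: vec_sum_eq_iff matrix_vector_mult_def sum_UNIV_Plus)

lemma block_mat_mult_block_mat:
  "block_mat S11 S12 S21 S22 ** block_mat T11 T12 T21 T22 =
     block_mat (S11 ** T11 + S12 ** T21) (S11 ** T12 + S12 ** T22)
               (S21 ** T11 + S22 ** T21) (S21 ** T12 + S22 ** T22)"
  by (simp add: mat_sum_eq_iff matrix_matrix_mult_def sum_UNIV_Plus)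

lemma transpose_block_mat:
  "transpose (block_mat S11 S12 S21 S22) =
     block_mat (transpose S11) (transpose S21) (transpose S12) (transpose S22)"
  by (simp add: mat_sum_eq_iff transpose_def)

lemma uminus_matrix_vector_mult: "(- S) *v v = - (S *v (v :: real^'n))"
  by (simp add: vec_eq_iff matrix_vector_mult_def sum_negf)

lemma transpose_zero [simp]: "transpose 0 = 0"
  by (simp add: transpose_def vec_eq_iff)

section \<open>Outer products and covariance\<close>

text \<open>
  The integrand of \<^const>\<open>cov\<close>, named so that it can be treated as a bounded bilinear map: algebraic
  rules for the covariance then follow by pulling bounded linear maps out of the integral.
\<close>
definition outer_product :: "real^'a \<Rightarrow> real^'b \<Rightarrow> real^'b^'a" where
  "outer_product a b = (columnvector a :: real^1^'a) ** transpose (columnvector b :: real^1^'b)"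

lemma outer_product_nth [simp]: "outer_product a b $ i $ j = a $ i * b $ j"
  by (simp add: outer_product_def matrix_matrix_mult_def columnvector_def transpose_def)

lemma bounded_bilinear_outer_product: "bounded_bilinear outer_product"
  unfolding bilinear_conv_bounded_bilinear[symmetric] bilinear_def
  by (auto intro!: linearI simp: vec_eq_iff algebra_simps)

interpretation outer_product: bounded_bilinear outer_product
  by (rule bounded_bilinear_outer_product)

lemma outer_product_matrix_left: "outer_product (S *v a) b = S ** outer_product a b"
  by (simp add: outer_product_def dot_rowvector_columnvector matrix_mul_assoc)

lemma transpose_outer_product: "transpose (outer_product a b) = outer_product b a"
  by (simp add: outer_product_def matrix_transpose_mul transpose_transpose)

lemma cov_outer_product:
  "cov M a b = (LINT w|M. outer_product (a w - (LINT v|M. a v)) (b w - (LINT v|M. b v)))"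
  by (simp add: cov_def outer_product_def)

text \<open>
  The closed-loop equations hold only on the sample space, so rewriting inside a covariance needs a
  congruence rule restricted to it.
\<close>
lemma cov_cong:
  assumes "\<And>w. w \<in> space M \<Longrightarrow> a w = a' w" "\<And>w. w \<in> space M \<Longrightarrow> b w = b' w"
  shows "cov M a b = cov M a' b'"
proof -
  have "(LINT v|M. a v) = (LINT v|M. a' v)" "(LINT v|M. b v) = (LINT v|M. b' v)"
    using assms by (auto intro: Bochner_Integration.integral_cong)
  then show ?thesis
    unfolding cov_outer_product using assms by (auto intro: Bochner_Integration.integral_cong)
qed

lemma bounded_linear_transpose: "bounded_linear (transpose :: real^'a^'b \<Rightarrow> real^'b^'a)"
  by (intro linear_conv_bounded_linear[THEN iffD1] linearI) (auto simp: transpose_def vec_eq_iff)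

lemma bounded_linear_matrix_mult_left: "bounded_linear (\<lambda>X::real^'a^'b. (S::real^'b^'c) ** X)"
  by (intro linear_conv_bounded_linear[THEN iffD1] linearI)
    (simp_all add: matrix_matrix_mult_def vec_eq_iff distrib_left sum.distrib sum_distrib_left mult.left_commute)

section \<open>Square-integrable random vectors\<close>

definition square_integrable :: "'w measure \<Rightarrow> ('w \<Rightarrow> real^'a) \<Rightarrow> bool" where
  "square_integrable M f \<longleftrightarrow> f \<in> borel_measurable M \<and> integrable M (\<lambda>w. (norm (f w))\<^sup>2)"

lemma square_integrable_cong:
  assumes "\<And>w. w \<in> space M \<Longrightarrow> a w = b w"
  shows "square_integrable M a \<longleftrightarrow> square_integrable M b"
  unfolding square_integrable_def
  using assms by (intro conj_cong measurable_cong Bochner_Integration.integrable_cong) auto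

lemma square_integrable_bounded_linear:
  assumes T: "bounded_linear T" and f: "square_integrable M f"
  shows "square_integrable M (\<lambda>w. T (f w))"
proof -
  obtain C where C: "\<And>v. norm (T v) \<le> norm v * C"
    using bounded_linear.bounded[OF T] by blast
  have m: "(\<lambda>w. T (f w)) \<in> borel_measurable M"
    using f T by (auto simp: square_integrable_def
        intro: borel_measurable_continuous_on[OF linear_continuous_on])
  have "integrable M (\<lambda>w. (norm (T (f w)))\<^sup>2)"
  proof (rule Bochner_Integration.integrable_bound)
    show "integrable M (\<lambda>w. C\<^sup>2 * (norm (f w))\<^sup>2)"
      using f by (simp add: square_integrable_def)
    show "(\<lambda>w. (norm (T (f w)))\<^sup>2) \<in> borel_measurable M"
      using m by simp
    have "(norm (T v))\<^sup>2 \<le> C\<^sup>2 * (norm v)\<^sup>2" for v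
      using power_mono[OF C[of v], of 2] by (simp add: power_mult_distrib mult.commute)
    then show "AE w in M. norm ((norm (T (f w)))\<^sup>2) \<le> norm (C\<^sup>2 * (norm (f w))\<^sup>2)"
      by simp
  qed
  with m show ?thesis by (simp add: square_integrable_def)
qed

lemma square_integrable_matrix_mult:
  "square_integrable M f \<Longrightarrow> square_integrable M (\<lambda>w. S *v f w)"
  by (rule square_integrable_bounded_linear[OF matrix_vector_mul_bounded_linear])

lemma square_integrable_add:
  fixes f g :: "'w \<Rightarrow> real^'n"
  assumes f: "square_integrable M f" and g: "square_integrable M g"
  shows "square_integrable M (\<lambda>w. f w + g w)"
proof -
  have m: "(\<lambda>w. f w + g w) \<in> borel_measurable M"
    using f g unfolding square_integrable_def by (intro borel_measurable_add) auto
  have "integrable M (\<lambda>w. (norm (f w + g w))\<^sup>2)"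
  proof (rule Bochner_Integration.integrable_bound)
    show "integrable M (\<lambda>w. 2 * ((norm (f w))\<^sup>2 + (norm (g w))\<^sup>2))"
      using f g by (simp add: square_integrable_def)
    show "(\<lambda>w. (norm (f w + g w))\<^sup>2) \<in> borel_measurable M"
      using m by simp
    have "(norm (a + b))\<^sup>2 \<le> 2 * ((norm a)\<^sup>2 + (norm b)\<^sup>2)" for a b :: "real^'n"
      using power_mono[OF norm_triangle_ineq[of a b], of 2]
        sum_squares_bound[of "norm a" "norm b"] by (simp add: power2_sum)
    then show "AE w in M. norm ((norm (f w + g w))\<^sup>2) \<le> norm (2 * ((norm (f w))\<^sup>2 + (norm (g w))\<^sup>2))"
      by simp
  qed
  with m show ?thesis by (simp add: square_integrable_def)
qed

lemma stack_vec_split: "stack_vec v w = stack_vec v 0 + stack_vec 0 w"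
  by (simp add: vec_sum_eq_iff)

lemma square_integrable_stack_vec:
  fixes f :: "'w \<Rightarrow> real^'n" and g :: "'w \<Rightarrow> real^'r"
  assumes "square_integrable M f" "square_integrable M g"
  shows "square_integrable M (\<lambda>w. stack_vec (f w) (g w))"
proof -
  have T: "bounded_linear (\<lambda>v::real^'n. stack_vec v (0::real^'r))"
       "bounded_linear (\<lambda>v::real^'r. stack_vec (0::real^'n) v)"
    by (intro linear_conv_bounded_linear[THEN iffD1] linearI; simp add: vec_sum_eq_iff)+
  show ?thesis
    using square_integrable_add[OF square_integrable_bounded_linear[OF T(1) assms(1)]
        square_integrable_bounded_linear[OF T(2) assms(2)]]
    by (subst stack_vec_split)
qed

text \<open>
  The recursion yields square integrability of the stacked vector only; splitting it off for the two
  parts is what allows the stacked covariance to be read as a block matrix.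
\<close>
lemma square_integrable_stack_vecD:
  fixes f :: "'w \<Rightarrow> real^'n" and g :: "'w \<Rightarrow> real^'r"
  assumes "square_integrable M (\<lambda>w. stack_vec (f w) (g w))"
  shows "square_integrable M f" "square_integrable M g"
proof -
  have "bounded_linear (\<lambda>v::real^('n + 'r). \<chi> i. v $ Inl i)" "bounded_linear (\<lambda>v::real^('n + 'r). \<chi> i. v $ Inr i)"
    by (intro linear_conv_bounded_linear[THEN iffD1] linearI; simp add: vec_eq_iff)+
  from square_integrable_bounded_linear[OF this(1) assms] square_integrable_bounded_linear[OF this(2) assms]
  show "square_integrable M f" "square_integrable M g"
    by simp_all
qed

text \<open>
  The bound \<open>\<parallel>a\<parallel> \<parallel>b\<parallel> \<le> \<parallel>a\<parallel>\<^sup>2 + \<parallel>b\<parallel>\<^sup>2\<close> dominates the outer product, so second moments suffice for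
  all covariances to be genuine integrals rather than the default value \<open>0\<close>.
\<close>
lemma integrable_outer_product:
  fixes f :: "'w \<Rightarrow> real^'n" and g :: "'w \<Rightarrow> real^'r"
  assumes f: "square_integrable M f" and g: "square_integrable M g"
  shows "integrable M (\<lambda>w. outer_product (f w) (g w))"
proof -
  obtain C where C: "C > 0" "\<And>a b. norm (outer_product a b :: real^'r^'n) \<le> norm a * norm b * C"
    using outer_product.pos_bounded by blast
  show ?thesis
  proof (rule Bochner_Integration.integrable_bound)
    show "integrable M (\<lambda>w. C * ((norm (f w))\<^sup>2 + (norm (g w))\<^sup>2))"
      using f g by (simp add: square_integrable_def)
    show "(\<lambda>w. outer_product (f w) (g w)) \<in> borel_measurable M"
    proof (rule borel_measurable_continuous_Pair[where H = outer_product])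
      show "f \<in> borel_measurable M" "g \<in> borel_measurable M"
        using f g by (simp_all add: square_integrable_def)
      show "continuous_on UNIV (\<lambda>v. outer_product (fst v :: real^'n) (snd v :: real^'r))"
        by (rule outer_product.continuous_on[OF continuous_on_fst[OF continuous_on_id]
              continuous_on_snd[OF continuous_on_id]])
    qed
    have "norm (outer_product a b) \<le> C * ((norm a)\<^sup>2 + (norm b)\<^sup>2)" for a :: "real^'n" and b :: "real^'r"
    proof -
      have "norm a * norm b \<le> (norm a)\<^sup>2 + (norm b)\<^sup>2"
        using sum_squares_bound[of "norm a" "norm b"] mult_nonneg_nonneg[of "norm a" "norm b"]
        by (simp del: mult_nonneg_nonneg)
      then have "C * (norm a * norm b) \<le> C * ((norm a)\<^sup>2 + (norm b)\<^sup>2)"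
        using C(1) by (intro mult_left_mono) auto
      with C(2)[of a b] show ?thesis by (simp add: mult.commute)
    qed
    then show "AE w in M. norm (outer_product (f w) (g w)) \<le> norm (C * ((norm (f w))\<^sup>2 + (norm (g w))\<^sup>2))"
      using C(1) by (auto intro: order_trans[OF _ abs_ge_self])
  qed
qed

lemma integral_nth:
  assumes "integrable M (f :: 'w \<Rightarrow> 'x::euclidean_space^'a)"
  shows "(LINT w|M. f w) $ i = (LINT w|M. f w $ i)"
  by (rule integral_bounded_linear[OF bounded_linear_vec_nth assms, symmetric])

section \<open>Bilinearity of the covariance\<close>

context prob_space
begin

lemma square_integrable_const: "square_integrable M (\<lambda>_. c)"
  by (simp add: square_integrable_def)

lemma square_integrable_imp_integrable_vec:
  assumes "square_integrable M f"
  shows "integrable M f"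
proof -
  have "integrable M (\<lambda>w. norm (f w))"
  proof (rule square_integrable_imp_integrable)
    show "(\<lambda>w. norm (f w)) \<in> borel_measurable M" "integrable M (\<lambda>w. (norm (f w))\<^sup>2)"
      using assms by (auto simp: square_integrable_def)
  qed
  with assms show ?thesis
    unfolding square_integrable_def by (blast dest: integrable_norm_cancel)
qed

lemma square_integrable_centered:
  assumes "square_integrable M f"
  shows "square_integrable M (\<lambda>w. f w - c)"
  using square_integrable_add[OF assms square_integrable_const[of "- c"]] by simp

lemma integrable_cov:
  assumes "square_integrable M a" "square_integrable M b"
  shows "integrable M (\<lambda>w. outer_product (a w - c) (b w - d))"
  by (rule integrable_outer_product[OF assms[THEN square_integrable_centered]])

lemma cov_nth:
  fixes a :: "'a \<Rightarrow> real^'n" and b :: "'a \<Rightarrow> real^'r"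
  assumes "square_integrable M a" "square_integrable M b"
  shows "cov M a b $ i $ j =
    (LINT w|M. (a w $ i - (LINT v|M. a v $ i)) * (b w $ j - (LINT v|M. b v $ j)))"
proof -
  have "bounded_linear (\<lambda>X::real^'r^'n. X $ i $ j)"
    by (intro bounded_linear_compose[OF bounded_linear_vec_nth] bounded_linear_vec_nth)
  from integral_bounded_linear[OF this integrable_cov[OF assms, of "expectation a" "expectation b"]]
  have "cov M a b $ i $ j = (LINT w|M. (a w $ i - expectation a $ i) * (b w $ j - expectation b $ j))"
    by (simp add: cov_outer_product)
  then show ?thesis
    by (simp add: integral_nth square_integrable_imp_integrable_vec assms)
qed

lemma cov_swap:
  assumes "square_integrable M a" "square_integrable M b"
  shows "cov M b a = transpose (cov M a b)"
  using integral_bounded_linear[OF bounded_linear_transpose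
      integrable_cov[OF assms, of "expectation a" "expectation b"]]
  by (simp only: cov_outer_product transpose_outer_product)

lemma cov_const_left: "cov M (\<lambda>_. c) b = 0"
  by (simp add: cov_outer_product prob_space outer_product.zero_left)

lemma cov_add_left:
  assumes "square_integrable M a" "square_integrable M a'" "square_integrable M b"
  shows "cov M (\<lambda>w. a w + a' w) b = cov M a b + cov M a' b"
proof -
  have "(LINT w|M. a w + a' w) = (LINT w|M. a w) + (LINT w|M. a' w)"
    using assms by (simp add: square_integrable_imp_integrable_vec)
  then have "cov M (\<lambda>w. a w + a' w) b =
      (LINT w|M. outer_product (a w - expectation a) (b w - expectation b) +
                 outer_product (a' w - expectation a') (b w - expectation b))"
    by (simp only: cov_outer_product add_diff_add outer_product.add_left)
  also have "\<dots> = cov M a b + cov M a' b"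
    unfolding cov_outer_product
    by (rule Bochner_Integration.integral_add) (rule integrable_cov, rule assms, rule assms)+
  finally show ?thesis .
qed

lemma integral_matrix_mult:
  assumes "square_integrable M a"
  shows "(LINT w|M. S *v a w) = S *v (LINT w|M. a w)"
  by (rule integral_bounded_linear[OF matrix_vector_mul_bounded_linear
        square_integrable_imp_integrable_vec[OF assms]])

lemma cov_matrix_mult_left:
  assumes "square_integrable M a" "square_integrable M b"
  shows "cov M (\<lambda>w. S *v a w) b = S ** cov M a b"
proof -
  have "cov M (\<lambda>w. S *v a w) b = (LINT w|M. S ** outer_product (a w - (LINT v|M. a v)) (b w - (LINT v|M. b v)))"
    by (simp only: cov_outer_product integral_matrix_mult[OF assms(1)]
        outer_product_matrix_left[symmetric] matrix_vector_mult_diff_distrib)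
  also have "\<dots> = S ** cov M a b"
    unfolding cov_outer_product
    by (rule integral_bounded_linear[OF bounded_linear_matrix_mult_left integrable_cov[OF assms]])
  finally show ?thesis .
qed

lemma cov_matrix_mult_right:
  assumes "square_integrable M a" "square_integrable M b"
  shows "cov M a (\<lambda>w. S *v b w) = cov M a b ** transpose S"
  using assms cov_swap[of a "\<lambda>w. S *v b w"] cov_swap[of "\<lambda>w. S *v b w" a] cov_swap[of a b] cov_matrix_mult_left[of b a S]
  by (simp add: square_integrable_matrix_mult matrix_transpose_mul transpose_transpose)

lemma cov_add_right:
  assumes "square_integrable M a" "square_integrable M b" "square_integrable M b'"
  shows "cov M a (\<lambda>w. b w + b' w) = cov M a b + cov M a b'"
proof -
  have "cov M a (\<lambda>w. b w + b' w) = transpose (cov M b a + cov M b' a)"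
    using assms by (subst cov_swap[of "\<lambda>w. b w + b' w"]) (auto simp: cov_add_left square_integrable_add)
  also have "\<dots> = transpose (cov M b a) + transpose (cov M b' a)"
    by (simp add: transpose_def vec_eq_iff)
  finally show ?thesis using assms by (simp add: cov_swap[symmetric])
qed

lemma cov_stack_vec:
  assumes "square_integrable M a" "square_integrable M b" "square_integrable M c" "square_integrable M d"
  shows "cov M (\<lambda>w. stack_vec (a w) (b w)) (\<lambda>w. stack_vec (c w) (d w)) =
    block_mat (cov M a c) (cov M a d) (cov M b c) (cov M b d)"
  using assms by (simp add: mat_sum_eq_iff cov_nth square_integrable_stack_vec)

lemma integral_stack_vec:
  assumes "square_integrable M a" "square_integrable M b"
  shows "(LINT w|M. stack_vec (a w) (b w)) = stack_vec (LINT w|M. a w) (LINT w|M. b w)"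
  using assms by (simp add: vec_sum_eq_iff integral_nth square_integrable_imp_integrable_vec
      square_integrable_stack_vec)

section \<open>Independence and Gaussian noise\<close>

text \<open>
  Independence is given for whole vectors, while product formulas for expectations concern real
  random variables; a centred component generates no events beyond those of its vector.
\<close>
lemma generated_events_component_shift:
  fixes a :: "'a \<Rightarrow> real^'n"
  shows "{(\<lambda>w. a w $ i - c) -` S \<inter> space M | S. S \<in> sets borel} \<subseteq> generated_events M a"
proof safe
  fix S :: "real set" assume "S \<in> sets borel"
  moreover have "(\<lambda>v::real^'n. v $ i - c) \<in> borel_measurable borel"
    by (intro borel_measurable_continuous_onI continuous_intros)
  ultimately have "(\<lambda>v::real^'n. v $ i - c) -` S \<in> sets borel"
    using measurable_sets[of "\<lambda>v::real^'n. v $ i - c" borel borel S] by simp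
  moreover have "(\<lambda>w. a w $ i - c) -` S \<inter> space M = a -` ((\<lambda>v. v $ i - c) -` S) \<inter> space M"
    by auto
  ultimately show "(\<lambda>w. a w $ i - c) -` S \<inter> space M \<in> generated_events M a"
    unfolding generated_events_def by (intro CollectI exI conjI)
qed

text \<open>
  Each entry is the expectation of a product of two independent centred components, hence the product
  of two zero expectations.
\<close>
lemma cov_eq_0_if_indep:
  assumes a: "square_integrable M a" and b: "square_integrable M b"
    and indep: "indep_set (generated_events M a) (generated_events M b)"
  shows "cov M a b = 0"
proof -
  have "cov M a b $ i $ j = 0" for i j
  proof -
    define c where "c = (LINT v|M. a v $ i)"
    define d where "d = (LINT v|M. b v $ j)"
    let ?X = "\<lambda>w. a w $ i - c" and ?Y = "\<lambda>w. b w $ j - d"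
    have int: "integrable M (\<lambda>w. a w $ i)" "integrable M (\<lambda>w. b w $ j)"
      using a b by (auto intro!: integrable_bounded_linear[OF bounded_linear_vec_nth]
          square_integrable_imp_integrable_vec)
    have "indep_var borel ?X borel ?Y"
      unfolding indep_var_def indep_vars_def2
    proof
      show "\<forall>k\<in>UNIV. random_variable (case k of True \<Rightarrow> borel | False \<Rightarrow> borel) (case k of True \<Rightarrow> ?X | False \<Rightarrow> ?Y)"
        using int by (auto split: bool.split)
      show "indep_sets (\<lambda>k. {(case k of True \<Rightarrow> ?X | False \<Rightarrow> ?Y) -` S \<inter> space M |S. S \<in> sets (case k of True \<Rightarrow> borel | False \<Rightarrow> borel)}) UNIV"
        using generated_events_component_shift[of a i c] generated_events_component_shift[of b j d]
        by (intro indep_sets_mono_sets[OF indep[unfolded indep_set_def]]) (auto split: bool.splits)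
    qed
    then have "(LINT w|M. ?X w * ?Y w) = (LINT w|M. ?X w) * (LINT w|M. ?Y w)"
      using int by (intro indep_var_lebesgue_integral) auto
    also have "\<dots> = 0"
      using int by (simp add: c_def prob_space)
    finally show ?thesis
      using a b by (simp add: cov_nth c_def d_def)
  qed
  then show ?thesis by (simp add: vec_eq_iff)
qed

text \<open>
  The five kinds of pairs of distinct sources that occur when a covariance of stacked vectors is split
  into blocks.
\<close>
lemma mutually_indep_pair:
  assumes "mutually_indep M x0 \<xi> \<omega>"
  shows "indep_set (generated_events M x0) (generated_events M (\<xi> t))"
    and "indep_set (generated_events M x0) (generated_events M (\<omega> t))"
    and "indep_set (generated_events M (\<xi> s)) (generated_events M (\<omega> t))"
    and "s \<noteq> t \<Longrightarrow> indep_set (generated_events M (\<xi> s)) (generated_events M (\<xi> t))"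
    and "s \<noteq> t \<Longrightarrow> indep_set (generated_events M (\<omega> s)) (generated_events M (\<omega> t))"
proof -
  define E where "E = (\<lambda>k. case k of
              Initial \<Rightarrow> generated_events M x0
            | Process_Noise s \<Rightarrow> generated_events M (\<xi> s)
            | Output_Noise s \<Rightarrow> generated_events M (\<omega> s))"
  have ind: "indep_sets E UNIV"
    using assms by (simp add: mutually_indep_def E_def)
  have pair: "indep_set (E k) (E l)" if "k \<noteq> l" for k l
  proof (rule indep_setI)
    show "E k \<subseteq> events" "E l \<subseteq> events"
      using ind by (auto simp: indep_sets_def)
    fix a b assume "a \<in> E k" "b \<in> E l"
    with that indep_setsD[OF ind, of "{k, l}" "\<lambda>m. if m = k then a else b"]
    show "prob (a \<inter> b) = prob a * prob b"
      by (auto simp: Int_commute)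
  qed
  show "indep_set (generated_events M x0) (generated_events M (\<xi> t))"
    using pair[of Initial "Process_Noise t"] by (simp add: E_def)
  show "indep_set (generated_events M x0) (generated_events M (\<omega> t))"
    using pair[of Initial "Output_Noise t"] by (simp add: E_def)
  show "indep_set (generated_events M (\<xi> s)) (generated_events M (\<omega> t))"
    using pair[of "Process_Noise s" "Output_Noise t"] by (simp add: E_def)
  show "indep_set (generated_events M (\<xi> s)) (generated_events M (\<xi> t))" if "s \<noteq> t"
    using pair[of "Process_Noise s" "Process_Noise t"] that by (simp add: E_def)
  show "indep_set (generated_events M (\<omega> s)) (generated_events M (\<omega> t))" if "s \<noteq> t"
    using pair[of "Output_Noise s" "Output_Noise t"] that by (simp add: E_def)
qed

text \<open>
  Off the diagonal, independence of the components factorizes the second moment; on it, the variance of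
  the standard normal density appears.
\<close>
lemma std_gaussian_vec_moments:
  assumes meas: "X \<in> borel_measurable M" and std: "std_gaussian_vec M X"
  shows "square_integrable M X" "(LINT w|M. X w) = 0" "cov M X X = mat 1"
proof -
  have dist: "distributed M lborel (\<lambda>w. X w $ i) std_normal_density" for i
    using std by (simp add: std_gaussian_vec_def)
  have sq: "integrable M (\<lambda>w. (X w $ i)\<^sup>2)" for i
    using distributed_integrable[OF dist[of i], of "\<lambda>x. x\<^sup>2"] integrable_std_normal_moment[of 2]
    by simp
  have "(norm (X w))\<^sup>2 = (\<Sum>i\<in>UNIV. (X w $ i)\<^sup>2)" for w
    by (simp add: norm_vec_def L2_set_def sum_nonneg)
  with sq meas show si: "square_integrable M X"
    by (simp add: square_integrable_def)
  note int = square_integrable_imp_integrable_vec[OF si]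
  have mean: "(LINT w|M. X w $ i) = 0" for i
    by (rule standard_normal_distributed_expectation[OF dist])
  with int show "(LINT w|M. X w) = 0"
    by (simp add: vec_eq_iff integral_nth)
  have "cov M X X $ i $ j = (if i = j then 1 else 0)" for i j
  proof (cases "i = j")
    case True
    then show ?thesis
      using standard_normal_distributed_variance[OF dist[of i]] si mean
      by (simp add: cov_nth power2_eq_square)
  next
    case False
    have "(LINT w|M. (\<Prod>k\<in>{i, j}. X w $ k)) = (\<Prod>k\<in>{i, j}. LINT w|M. X w $ k)"
      using std int by (intro indep_vars_lebesgue_integral)
        (auto simp: std_gaussian_vec_def intro: indep_vars_subset integrable_bounded_linear[OF bounded_linear_vec_nth])
    with False si mean show ?thesis
      by (simp add: cov_nth)
  qed
  then show "cov M X X = mat 1"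
    by (simp add: vec_eq_iff mat_def)
qed

lemma linear_image_std_gaussian_moments:
  assumes "X \<in> borel_measurable M" "std_gaussian_vec M X"
    and eq: "\<And>w. w \<in> space M \<Longrightarrow> Y w = S *v X w"
  shows "square_integrable M Y" "(LINT w|M. Y w) = 0" "cov M Y Y = S ** transpose S"
proof -
  note X = std_gaussian_vec_moments[OF assms(1,2)]
  show "square_integrable M Y"
    using square_integrable_cong[of M Y, OF eq] X(1) by (simp add: square_integrable_matrix_mult)
  have "(LINT w|M. Y w) = (LINT w|M. S *v X w)"
    using eq by (intro Bochner_Integration.integral_cong) auto
  also have "\<dots> = S *v (LINT w|M. X w)"
    by (rule integral_matrix_mult[OF X(1)])
  finally show "(LINT w|M. Y w) = 0"
    using X(2) by simp
  have "cov M Y Y = cov M (\<lambda>w. S *v X w) (\<lambda>w. S *v X w)"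
    using eq by (intro cov_cong)
  then show "cov M Y Y = S ** transpose S"
    using X by (simp add: cov_matrix_mult_left cov_matrix_mult_right square_integrable_matrix_mult)
qed

section \<open>Linear recursions driven by uncorrelated noise\<close>

text \<open>
  Induction on \<open>t\<close>. The claim must cover all future noises \<open>e k\<close>, \<open>k \<ge> t\<close>, at once: in the step,
  \<open>z (Suc t)\<close> inherits it from \<open>z t\<close> and from \<open>e t\<close>, which is uncorrelated with every strictly later
  noise.
\<close>
lemma linear_recursion_uncorrelated:
  assumes z0: "square_integrable M (z 0)" and e: "\<And>k. square_integrable M (e k)"
    and z0_e: "\<And>k. cov M (z 0) (e k) = 0"
    and e_e: "\<And>j k. j \<noteq> k \<Longrightarrow> cov M (e j) (e k) = 0"
    and step: "\<And>t w. t < N \<Longrightarrow> w \<in> space M \<Longrightarrow> z (Suc t) w = F t *v z t w + G t *v e t w"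
    and "t \<le> N"
  shows "square_integrable M (z t) \<and> (\<forall>k\<ge>t. cov M (z t) (e k) = 0)"
  using \<open>t \<le> N\<close>
proof (induction t)
  case 0
  show ?case using z0 z0_e by simp
next
  case (Suc t)
  then have IH: "square_integrable M (z t)" "\<And>k. k \<ge> t \<Longrightarrow> cov M (z t) (e k) = 0"
    by auto
  have eq: "\<And>w. w \<in> space M \<Longrightarrow> z (Suc t) w = F t *v z t w + G t *v e t w"
    using Suc.prems by (intro step) auto
  have "square_integrable M (z (Suc t))"
    using square_integrable_cong[of M "z (Suc t)", OF eq] IH(1) e
    by (simp add: square_integrable_add square_integrable_matrix_mult)
  moreover have "cov M (z (Suc t)) (e k) = 0" if "k \<ge> Suc t" for k
  proof -
    have "cov M (z (Suc t)) (e k) = cov M (\<lambda>w. F t *v z t w + G t *v e t w) (e k)"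
      using eq by (intro cov_cong) auto
    also have "\<dots> = F t ** cov M (z t) (e k) + G t ** cov M (e t) (e k)"
      using IH(1) e by (simp add: cov_add_left cov_matrix_mult_left square_integrable_matrix_mult)
    finally show ?thesis
      using IH(2)[of k] e_e[of t k] that by simp
  qed
  ultimately show ?case by blast
qed

lemma moments_of_linear_update:
  assumes z: "square_integrable M z" and e: "square_integrable M e"
    and mean: "(LINT w|M. e w) = 0" and uncorr: "cov M z e = 0"
    and eq: "\<And>w. w \<in> space M \<Longrightarrow> z' w = F *v z w + G *v e w"
  shows "(LINT w|M. z' w) = F *v (LINT w|M. z w)"
    and "cov M z' z' = F ** cov M z z ** transpose F + G ** cov M e e ** transpose G"
proof -
  have "(LINT w|M. z' w) = (LINT w|M. F *v z w + G *v e w)"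
    using eq by (intro Bochner_Integration.integral_cong) auto
  also have "\<dots> = (LINT w|M. F *v z w) + (LINT w|M. G *v e w)"
    using z e by (intro Bochner_Integration.integral_add square_integrable_imp_integrable_vec
        square_integrable_matrix_mult)
  also have "\<dots> = F *v (LINT w|M. z w) + G *v (LINT w|M. e w)"
    by (simp only: integral_matrix_mult[OF z] integral_matrix_mult[OF e])
  finally show "(LINT w|M. z' w) = F *v (LINT w|M. z w)"
    using mean by simp
  have "cov M e z = 0"
    using cov_swap[OF z e] uncorr by (simp add: transpose_def vec_eq_iff)
  moreover have "cov M z' z' = cov M (\<lambda>w. F *v z w + G *v e w) (\<lambda>w. F *v z w + G *v e w)"
    using eq by (intro cov_cong)
  ultimately show "cov M z' z' = F ** cov M z z ** transpose F + G ** cov M e e ** transpose G"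
    using z e uncorr
    by (simp add: cov_add_left cov_add_right cov_matrix_mult_left cov_matrix_mult_right
        square_integrable_add square_integrable_matrix_mult matrix_mul_assoc)
qed

end

section \<open>Mean and covariance of the closed loop\<close>

theorem lemma1:
  fixes M :: "'w measure"
    and N :: nat
    and A :: "nat \<Rightarrow> real^'n^'n" and B :: "nat \<Rightarrow> real^'m^'n" and H :: "nat \<Rightarrow> real^'n^'r"
    and \<Sigma>\<xi> :: "real^'p^'n" and \<Sigma>\<omega> :: "real^'q^'r"
    and \<Omega>\<xi> :: "real^'n^'n" and \<Omega>\<omega> :: "real^'r^'r"
    and Q\<^sub>N Q :: "real^'n^'n" and R :: "real^'m^'m"
    and Z P :: "nat \<Rightarrow> real^'n^'n" and L :: "nat \<Rightarrow> real^'n^'m" and K :: "nat \<Rightarrow> real^'r^'n"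
    and \<alpha> :: "nat \<Rightarrow> 'w \<Rightarrow> real^'p" and \<beta> :: "nat \<Rightarrow> 'w \<Rightarrow> real^'q"
    and \<xi> :: "nat \<Rightarrow> 'w \<Rightarrow> real^'n" and \<omega> :: "nat \<Rightarrow> 'w \<Rightarrow> real^'r"
    and x xhat :: "nat \<Rightarrow> 'w \<Rightarrow> real^'n"
    and u :: "nat \<Rightarrow> 'w \<Rightarrow> real^'m" and y :: "nat \<Rightarrow> 'w \<Rightarrow> real^'r"
  assumes prob: "prob_space M"
    and white_\<alpha>: "std_white_gaussian M \<alpha>"
    and white_\<beta>: "std_white_gaussian M \<beta>"
    and \<xi>_eq: "\<And>t w. w \<in> space M \<Longrightarrow> \<xi> t w = \<Sigma>\<xi> *v \<alpha> t w"
    and \<omega>_eq: "\<And>t w. w \<in> space M \<Longrightarrow> \<omega> t w = \<Sigma>\<omega> *v \<beta> t w"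
    and \<Omega>\<xi>_eq: "\<Omega>\<xi> = \<Sigma>\<xi> ** transpose \<Sigma>\<xi>"
    and \<Omega>\<omega>_eq: "\<Omega>\<omega> = \<Sigma>\<omega> ** transpose \<Sigma>\<omega>"
    and \<Omega>\<omega>_pos: "pos_def \<Omega>\<omega>"
    and x0_square_integrable: "integrable M (\<lambda>w. (norm (x 0 w))\<^sup>2)"
    and indep: "mutually_indep M (x 0) \<xi> \<omega>"
    and Q\<^sub>N_psd: "pos_semidef Q\<^sub>N" and Q_psd: "pos_semidef Q" and R_pos: "pos_def R"
    and Z_final: "Z N = Q\<^sub>N"
    and Z_step: "\<And>t. t < N \<Longrightarrow>
          Z t = Q + transpose (A t) ** Z (Suc t) ** (A t - B t ** L t)"
    and L_eq: "\<And>t. t < N \<Longrightarrow>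
          L t = matrix_inv (R + transpose (B t) ** Z (Suc t) ** B t)
                  ** transpose (B t) ** Z (Suc t) ** A t"
    and P_init: "P 0 = cov M (x 0) (x 0)"
    and P_step: "\<And>t. t < N \<Longrightarrow>
          P (Suc t) = \<Omega>\<xi> + (A t - K t ** H t) ** P t ** transpose (A t)"
    and K_eq: "\<And>t. t < N \<Longrightarrow>
          K t = A t ** P t ** transpose (H t)
                  ** matrix_inv (H t ** P t ** transpose (H t) + \<Omega>\<omega>)"
    and x_step: "\<And>t w. t < N \<Longrightarrow> w \<in> space M \<Longrightarrow>
          x (Suc t) w = A t *v x t w + B t *v u t w + \<xi> t w"
    and y_eq: "\<And>t w. t < N \<Longrightarrow> w \<in> space M \<Longrightarrow> y t w = H t *v x t w + \<omega> t w"
    and u_eq: "\<And>t w. t < N \<Longrightarrow> w \<in> space M \<Longrightarrow> u t w = - (L t *v xhat t w)"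
    and xhat_init: "\<And>w. w \<in> space M \<Longrightarrow> xhat 0 w = (LINT v|M. x 0 v)"
    and xhat_step: "\<And>t w. t < N \<Longrightarrow> w \<in> space M \<Longrightarrow>
          xhat (Suc t) w = A t *v xhat t w + B t *v u t w + K t *v (y t w - H t *v xhat t w)"
  shows "(LINT w|M. xhat 0 w) = (LINT w|M. x 0 w) \<and>
    joint_cov M (x 0) (xhat 0) = block_mat (cov M (x 0) (x 0)) 0 0 0 \<and>
    (\<forall>t<N.
      stack_vec (LINT w|M. x (Suc t) w) (LINT w|M. xhat (Suc t) w) =
        closed_loop_mat (A t) (B t) (H t) (L t) (K t) *v
          stack_vec (LINT w|M. x t w) (LINT w|M. xhat t w) \<and>
      joint_cov M (x (Suc t)) (xhat (Suc t)) =
        closed_loop_mat (A t) (B t) (H t) (L t) (K t) ** joint_cov M (x t) (xhat t)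
          ** transpose (closed_loop_mat (A t) (B t) (H t) (L t) (K t))
        + block_mat \<Omega>\<xi> 0 0 (K t ** \<Omega>\<omega> ** transpose (K t)))"
proof -
  interpret prob_space M by (rule prob)
  have white_meas: "\<alpha> t \<in> borel_measurable M" "std_gaussian_vec M (\<alpha> t)"
      "\<beta> t \<in> borel_measurable M" "std_gaussian_vec M (\<beta> t)" for t
    using white_\<alpha> white_\<beta> by (auto simp: std_white_gaussian_def indep_vars_def2)
  note \<xi> = linear_image_std_gaussian_moments[OF white_meas(1,2) \<xi>_eq, folded \<Omega>\<xi>_eq]
  note \<omega> = linear_image_std_gaussian_moments[OF white_meas(3,4) \<omega>_eq, folded \<Omega>\<omega>_eq]
  have x0: "square_integrable M (x 0)"
    using x0_square_integrable indep by (simp add: square_integrable_def mutually_indep_def)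
  have xhat0: "square_integrable M (xhat 0)"
    using square_integrable_cong[of M "xhat 0", OF xhat_init] by (simp add: square_integrable_const)
  have cov_xhat0: "cov M (xhat 0) b = 0" for b :: "'w \<Rightarrow> real^'b"
    using cov_cong[of M "xhat 0" _ b b, OF xhat_init] by (simp add: cov_const_left)
  note pair = mutually_indep_pair[OF indep]

  define z where "z = (\<lambda>t w. stack_vec (x t w) (xhat t w))"
  define e where "e = (\<lambda>t w. stack_vec (\<xi> t w) (\<omega> t w))"
  define F where "F = (\<lambda>t. closed_loop_mat (A t) (B t) (H t) (L t) (K t))"
  define G where "G = (\<lambda>t. block_mat (mat 1 :: real^'n^'n) (0 :: real^'r^'n) 0 (K t))"

  have e_sq: "square_integrable M (e k)" for k
    unfolding e_def by (intro square_integrable_stack_vec \<xi> \<omega>)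
  have e_mean: "(LINT w|M. e k w) = 0" for k
    unfolding e_def by (simp add: integral_stack_vec \<xi> \<omega> vec_sum_eq_iff)
  have e_cov: "cov M (e k) (e k) = block_mat \<Omega>\<xi> 0 0 \<Omega>\<omega>" for k
  proof -
    have "cov M (\<xi> k) (\<omega> k) = 0"
      by (intro cov_eq_0_if_indep \<xi> \<omega> pair)
    moreover from this have "cov M (\<omega> k) (\<xi> k) = 0"
      using cov_swap[OF \<xi>(1) \<omega>(1)] by (simp add: transpose_def vec_eq_iff)
    ultimately show ?thesis
      unfolding e_def by (simp add: cov_stack_vec \<xi> \<omega>)
  qed
  have e_e: "cov M (e j) (e k) = 0" if "j \<noteq> k" for j k
  proof -
    have "cov M (\<xi> j) (\<xi> k) = 0" "cov M (\<omega> j) (\<omega> k) = 0" "cov M (\<xi> j) (\<omega> k) = 0" "cov M (\<xi> k) (\<omega> j) = 0"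
      using that by (auto intro!: cov_eq_0_if_indep \<xi> \<omega> pair)
    moreover from this have "cov M (\<omega> j) (\<xi> k) = 0"
      using cov_swap[OF \<xi>(1) \<omega>(1)] by (simp add: transpose_def vec_eq_iff)
    ultimately show ?thesis
      unfolding e_def by (simp add: cov_stack_vec \<xi> \<omega> mat_sum_eq_iff)
  qed
  have z0: "square_integrable M (z 0)"
    unfolding z_def by (intro square_integrable_stack_vec x0 xhat0)
  have z0_e: "cov M (z 0) (e k) = 0" for k
  proof -
    have "cov M (x 0) (\<xi> k) = 0" "cov M (x 0) (\<omega> k) = 0"
      by (auto intro!: cov_eq_0_if_indep x0 \<xi> \<omega> pair)
    then show ?thesis
      unfolding z_def e_def by (simp add: cov_stack_vec x0 xhat0 \<xi> \<omega> cov_xhat0 mat_sum_eq_iff)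
  qed
  have step: "z (Suc t) w = F t *v z t w + G t *v e t w" if "t < N" "w \<in> space M" for t w
    using that
    by (simp add: z_def e_def F_def G_def closed_loop_mat_def block_mat_mult_stack_vec
        x_step xhat_step u_eq y_eq vec_sum_eq_iff)
      (simp add: algebra_simps matrix_vector_mul_assoc linear_neg[OF matrix_vector_mul_linear] uminus_matrix_vector_mult)
  \<comment> \<open>This holds up to time \<open>N\<close> included, since the left-hand sides concern time \<open>Suc t\<close>.\<close>
  have z: "square_integrable M (z t)" "cov M (z t) (e t) = 0" if "t \<le> N" for t
    using linear_recursion_uncorrelated[of z e N F G t] z0 e_sq z0_e e_e step that by auto
  have x_xhat: "square_integrable M (x t)" "square_integrable M (xhat t)" if "t \<le> N" for t
    using square_integrable_stack_vecD z(1)[OF that] unfolding z_def by blast+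
  have joint: "joint_cov M (x t) (xhat t) = cov M (z t) (z t)"
    and mean: "stack_vec (LINT w|M. x t w) (LINT w|M. xhat t w) = (LINT w|M. z t w)" if "t \<le> N" for t
    using x_xhat[OF that] by (simp_all add: joint_cov_def z_def cov_stack_vec integral_stack_vec)
  have G_cov: "G t ** block_mat \<Omega>\<xi> 0 0 \<Omega>\<omega> ** transpose (G t) =
      block_mat \<Omega>\<xi> 0 0 (K t ** \<Omega>\<omega> ** transpose (K t))" for t
    by (simp add: G_def transpose_block_mat block_mat_mult_block_mat)

  show ?thesis
  proof (intro conjI allI impI)
    show "(LINT w|M. xhat 0 w) = (LINT w|M. x 0 w)"
      using Bochner_Integration.integral_cong[of M M "xhat 0", OF refl xhat_init] by (simp add: prob_space)
    have "cov M (x 0) (xhat 0) = 0"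
      using cov_swap[OF xhat0 x0] by (simp add: cov_xhat0 transpose_def vec_eq_iff)
    then show "joint_cov M (x 0) (xhat 0) = block_mat (cov M (x 0) (x 0)) 0 0 0"
      by (simp add: joint_cov_def cov_xhat0)
  next
    fix t assume t: "t < N"
    note update = moments_of_linear_update[OF z(1) e_sq e_mean z(2) step, of t]
    show "stack_vec (LINT w|M. x (Suc t) w) (LINT w|M. xhat (Suc t) w) =
        closed_loop_mat (A t) (B t) (H t) (L t) (K t) *v
          stack_vec (LINT w|M. x t w) (LINT w|M. xhat t w)"
      using t update(1) by (simp add: mean F_def)
    show "joint_cov M (x (Suc t)) (xhat (Suc t)) =
        closed_loop_mat (A t) (B t) (H t) (L t) (K t) ** joint_cov M (x t) (xhat t)
          ** transpose (closed_loop_mat (A t) (B t) (H t) (L t) (K t))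
        + block_mat \<Omega>\<xi> 0 0 (K t ** \<Omega>\<omega> ** transpose (K t))"
      using t update(2) by (simp add: joint F_def e_cov G_cov)
  qed
qed

end
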